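(* Let $\mathbf{X}\in\mathbb{R}^{n\times p}$ have columns $\mathbf{X}_1,\dots,\mathbf{X}_p$, let $\mathbf{y}\in\mathbb{R}^n$, and let $\boldsymbol{\beta}^{k-1}\in\mathbb{R}^p$ be a vector with support $S_{k-1}=\operatorname{supp}(\boldsymbol{\beta}^{k-1})\subsetneq\{1,\dots,p\}$ whose restriction to $S_{k-1}$ is the least-squares coefficient vector $(\mathbf{X}_{S_{k-1}}^T\mathbf{X}_{S_{k-1}})^{-1}\mathbf{X}_{S_{k-1}}^T\mathbf{y}$. Put $\mathbf{r}^k=\mathbf{y}-\mathbf{X}\boldsymbol{\beta}^{k-1}$. Assume that $\mathbf{X}_{S_{k-1}\cup\{j\}}$ has full column rank for every $j\in S_{k-1}^c$. Then the problem $$\operatorname*{argmax}_{S}\ \mathbf{y}^T\mathbf{X}_S(\mathbf{X}_S^T\mathbf{X}_S)^{-1}\mathbf{X}_S^T\mathbf{y}\quad\text{subject to } S_{k-1}\subset S\subset\{1,\dots,p\},\ |S|=|S_{k-1}|+1$$ is equivalent, in the sense of identifying the same subset, to the problem $$\operatorname*{argmax}_{j\in S_{k-1}^c}\ \frac{\left({\mathbf{r}^k}^T\mathbf{X}_j\right)^2}{\mathbf{X}_j^T\left(\mathbf{I}-\mathbf{X}_{S_{k-1}}(\mathbf{X}_{S_{k-1}}^T\mathbf{X}_{S_{k-1}})^{-1}\mathbf{X}_{S_{k-1}}^T\right)\mathbf{X}_j}.$$ That is, an index $j\in S_{k-1}^c$ solves the second problem if and only if $S=S_{k-1}\cup\{j\}$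 solves the first.
   Context: For an index set $S\subset\{1,\dots,p\}$, $\mathbf{X}_S$ is the submatrix of $\mathbf{X}$ consisting of the columns with index in $S$, $S^c$ is the complement of $S$ in $\{1,\dots,p\}$, and $\operatorname{supp}(\boldsymbol{\beta})$ is the set of indices of nonzero entries of $\boldsymbol{\beta}$. If $S$ is empty, $\mathbf{X}_S(\mathbf{X}_S^T\mathbf{X}_S)^{-1}\mathbf{X}_S^T$ is the zero matrix. *)

theory Defs
  imports
    Jordan_Normal_Form.DL_Rank
    Jordan_Normal_Form.DL_Submatrix
    Jordan_Normal_Form.Gauss_Jordan_Elimination
    Complex_Main
begin

text \<open>Coordinates and columns are numbered from \<open>0\<close>, as usual for \<^typ>\<open>'a vec\<close> and \<^typ>\<open>'a mat\<close>;
  the index set \<open>{1,\<dots>,p}\<close> of the mathematics becomes \<open>{..<p}\<close>.\<close>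

definition supp :: "'a::zero vec \<Rightarrow> nat set" where
  "supp v = {i. i < dim_vec v \<and> v $ i \<noteq> 0}"

definition cols_submat :: "'a mat \<Rightarrow> nat set \<Rightarrow> 'a mat" where
  "cols_submat X S = submatrix X UNIV S"

text \<open>The selected entries keep their order, which matches the column order of \<^const>\<open>cols_submat\<close>.\<close>

definition restrict_vec :: "'a vec \<Rightarrow> nat set \<Rightarrow> 'a vec" where
  "restrict_vec v S = vec (card {i. i < dim_vec v \<and> i \<in> S}) (\<lambda>i. v $ pick S i)"

text \<open>The inverse of an invertible matrix, an unspecified value for any other matrix.\<close>

definition inv_mat :: "'a::field mat \<Rightarrow> 'a mat" where
  "inv_mat A = the (mat_inverse A)"

lemma inv_mat:
  fixes A :: "'a::field mat"
  assumes A: "A \<in> carrier_mat n n" and inv: "invertible_mat A"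
  shows "inv_mat A \<in> carrier_mat n n" "A * inv_mat A = 1\<^sub>m n" "inv_mat A * A = 1\<^sub>m n"
proof -
  from inv obtain B where AB: "A * B = 1\<^sub>m (dim_row A)" and BA: "B * A = 1\<^sub>m (dim_row B)"
    unfolding invertible_mat_def inverts_mat_def by blast
  have "dim_col B = n" using arg_cong[OF AB, of dim_col] A by simp
  moreover have "dim_row B = n" using arg_cong[OF BA, of dim_col] A by simp
  ultimately have B: "B \<in> carrier_mat n n" by (rule carrier_matI[rotated])
  have "A \<in> Units (ring_mat TYPE('a) n ())"
    unfolding Units_def mem_Collect_eq ring_mat_simps
    using A B AB BA by (intro conjI bexI[of _ B]) simp_all
  then obtain C where C: "mat_inverse A = Some C"
    using mat_inverse(1)[OF A, of "()"] by (cases "mat_inverse A") blast+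
  then show "inv_mat A \<in> carrier_mat n n" "A * inv_mat A = 1\<^sub>m n" "inv_mat A * A = 1\<^sub>m n"
    using mat_inverse(2)[OF A C] by (simp_all add: inv_mat_def)
qed

definition full_col_rank :: "'a::field mat \<Rightarrow> bool" where
  "full_col_rank A \<longleftrightarrow> vec_space.rank (dim_row A) A = dim_col A"

definition ls_coeff :: "'a::field mat \<Rightarrow> nat set \<Rightarrow> 'a vec \<Rightarrow> 'a vec" where
  "ls_coeff X S y =
    (inv_mat ((cols_submat X S)\<^sup>T * cols_submat X S) * (cols_submat X S)\<^sup>T) *\<^sub>v y"

definition proj_mat :: "'a::field mat \<Rightarrow> nat set \<Rightarrow> 'a mat" where
  "proj_mat X S =
    cols_submat X S * inv_mat ((cols_submat X S)\<^sup>T * cols_submat X S) * (cols_submat X S)\<^sup>T"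

text \<open>The convention for empty \<open>S\<close> needs no separate clause: \<^term>\<open>cols_submat X {}\<close> has no columns
  and the empty matrix is its own inverse.\<close>

lemma proj_mat_empty: "proj_mat X {} = 0\<^sub>m (dim_row X) (dim_row X)"
proof -
  let ?A = "cols_submat X {}" and ?B = "(cols_submat X {})\<^sup>T * cols_submat X {}"
  have A: "?A \<in> carrier_mat (dim_row X) 0"
    by (rule carrier_matI) (simp_all add: cols_submat_def dim_submatrix)
  have "?B * ?B = 1\<^sub>m (dim_row ?B)"
    by (rule eq_matI) (use A in auto)
  then have "invertible_mat ?B"
    unfolding invertible_mat_def inverts_mat_def square_mat.simps by (intro conjI exI[of _ ?B]) simp_all
  then have "inv_mat ?B \<in> carrier_mat 0 0"
    using A by (intro inv_mat(1)) simp_all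
  then show ?thesis
    unfolding proj_mat_def by (intro eq_matI) (use A in \<open>simp_all add: scalar_prod_def\<close>)
qed

end

theory Submission
  imports Defs
begin

text \<open>
  Write \<open>P\<^sub>T\<close> for the matrix \<^term>\<open>proj_mat X T\<close>, the orthogonal projection onto the span of the columns
  of \<open>X\<close> with index in \<open>T\<close> when these are independent. The two problems are equivalent because their objectives differ by a
  constant: for every admissible \<open>j\<close>,
  \<open>y \<bullet> P\<^bsub>S \<union> {j}\<^esub> y = y \<bullet> P\<^sub>S y + (r \<bullet> x)\<^sup>2 / (x \<bullet> (I - P\<^sub>S) x)\<close> with \<open>x = col X j\<close>
  (lemma \<open>proj_mat_insert\<close>), and \<open>j \<mapsto> S \<union> {j}\<close> maps the feasible indices onto the feasible sets.

  The identity is one step of Gram-Schmidt. The vector \<open>u = (I - P\<^sub>S) x\<close> is the part of the new column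
  that is orthogonal to the old ones, and it is nonzero by independence, so projecting onto the
  larger span adds to \<open>P\<^sub>S y\<close> the projection \<open>(y \<bullet> u / u \<bullet> u) u\<close> of \<open>y\<close> onto the line of \<open>u\<close>.
  Here \<open>u \<bullet> u = u \<bullet> x\<close>, and \<open>y \<bullet> u = r \<bullet> x\<close> because the least-squares hypothesis makes
  \<open>r = y - P\<^sub>S y\<close> (lemma \<open>mult_ls_coeff\<close>).

  Comparing \<open>P\<^bsub>S \<union> {j}\<^esub>\<close> with \<open>P\<^sub>S\<close> as matrix products would require tracking where column \<open>j\<close> is
  inserted among the columns of \<open>S\<close>. Instead, a projection is characterised by membership in the
  span and orthogonality of the residual (\<open>orth_proj\<close>), with coefficient vectors indexed by all
  columns and supported in \<open>T\<close>. The characterisation determines the projection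
  (lemma \<open>orth_proj_unique\<close>), is met by \<open>P\<^sub>T\<close> (lemma \<open>orth_proj_proj_mat\<close>), and makes the update by one
  column a direct verification (lemma \<open>orth_proj_insert\<close>).
\<close>

section \<open>Selected columns\<close>

lemma supp_subset_iff:
  "supp c \<subseteq> T \<longleftrightarrow> (\<forall>i < dim_vec c. i \<notin> T \<longrightarrow> c $ i = 0)"
  unfolding supp_def by auto

lemma bij_betw_pick:
  assumes "finite T"
  shows "bij_betw (pick T) {..<card T} T"
proof -
  have inj: "inj_on (pick T) {..<card T}"
    by (rule linorder_inj_onI) (use pick_mono_le in \<open>fastforce+\<close>)
  have "pick T ` {..<card T} \<subseteq> T" using pick_in_set_le by auto
  then have "pick T ` {..<card T} = T"
    using card_image[OF inj] assms by (intro card_subset_eq) auto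
  with inj show ?thesis by (simp add: bij_betw_def)
qed

context
  fixes X :: "'a::field mat" and n p :: nat and T :: "nat set"
  assumes X: "X \<in> carrier_mat n p" and T: "T \<subseteq> {..<p}"
begin

lemma index_set_eq: "{j. j < p \<and> j \<in> T} = T"
  using T by auto

lemma finite_index_set: "finite T"
  using T finite_subset by blast

lemma pick_index: "k < card T \<Longrightarrow> pick T k \<in> T" "k < card T \<Longrightarrow> pick T k < p"
  using pick_in_set_le T by auto

lemma cols_submat_carrier: "cols_submat X T \<in> carrier_mat n (card T)"
  using X by (intro carrier_matI) (simp_all add: cols_submat_def dim_submatrix index_set_eq)

lemma cols_submat_index:
  assumes "i < n" "k < card T"
  shows "cols_submat X T $$ (i, k) = X $$ (i, pick T k)"
proof -
  have "cols_submat X T $$ (i, k) = X $$ (pick UNIV i, pick T k)"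
    unfolding cols_submat_def using assms X by (intro submatrix_index) (simp_all add: index_set_eq)
  then show ?thesis by (simp add: pick_UNIV)
qed

lemma restrict_vec_carrier:
  "c \<in> carrier_vec p \<Longrightarrow> restrict_vec c T \<in> carrier_vec (card T)"
  by (simp add: restrict_vec_def index_set_eq)

lemma restrict_vec_index:
  "c \<in> carrier_vec p \<Longrightarrow> k < card T \<Longrightarrow> restrict_vec c T $ k = c $ pick T k"
  by (simp add: restrict_vec_def index_set_eq)

text \<open>With \<open>restrict_vec_surj\<close> below, this translates between coefficient vectors for the submatrix
  and coefficient vectors for \<open>X\<close> supported in \<open>T\<close>; the latter do not
  depend on the position of a column within the submatrix.\<close>

lemma cols_submat_mult_restrict_vec:
  assumes c: "c \<in> carrier_vec p" and supp: "supp c \<subseteq> T"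
  shows "cols_submat X T *\<^sub>v restrict_vec c T = X *\<^sub>v c"
proof (rule eq_vecI)
  fix i assume "i < dim_vec (X *\<^sub>v c)"
  then have i: "i < n" using X by simp
  have "(cols_submat X T *\<^sub>v restrict_vec c T) $ i
      = (\<Sum>k<card T. X $$ (i, pick T k) * c $ pick T k)"
    using i cols_submat_carrier restrict_vec_carrier[OF c]
    by (simp add: scalar_prod_def atLeast0LessThan cols_submat_index restrict_vec_index c)
  also have "\<dots> = (\<Sum>j\<in>T. X $$ (i, j) * c $ j)"
    by (rule sum.reindex_bij_betw[OF bij_betw_pick[OF finite_index_set]])
  also have "\<dots> = (\<Sum>j<p. X $$ (i, j) * c $ j)"
    using T supp c by (intro sum.mono_neutral_left) (auto simp: supp_subset_iff)
  also have "\<dots> = (X *\<^sub>v c) $ i"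
    using i X c by (simp add: scalar_prod_def atLeast0LessThan)
  finally show "(cols_submat X T *\<^sub>v restrict_vec c T) $ i = (X *\<^sub>v c) $ i" .
qed (use X cols_submat_carrier in simp)

lemma restrict_vec_surj:
  assumes v: "v \<in> carrier_vec (card T)"
  shows "\<exists>c \<in> carrier_vec p. supp c \<subseteq> T \<and> restrict_vec c T = v"
proof -
  define g where "g = inv_into {..<card T} (pick T)"
  define c where "c = vec p (\<lambda>j. if j \<in> T then v $ g j else 0)"
  have g: "g (pick T k) = k" if "k < card T" for k
    using that bij_betw_pick[OF finite_index_set] by (simp add: g_def bij_betw_def)
  have c: "c \<in> carrier_vec p" by (simp add: c_def)
  moreover have "supp c \<subseteq> T" by (simp add: supp_subset_iff c_def)
  moreover have "restrict_vec c T = v"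
    using v restrict_vec_carrier[OF c] restrict_vec_index[OF c]
    by (intro eq_vecI) (simp_all add: c_def g pick_index)
  ultimately show ?thesis by blast
qed

end

section \<open>Independence of columns\<close>

text \<open>Coefficients are indexed by all columns rather than by the selected ones, so that passing to a
  subset of \<open>T\<close> only strengthens the support condition.\<close>

definition indep_cols :: "'a::field mat \<Rightarrow> nat set \<Rightarrow> bool" where
  "indep_cols X T \<longleftrightarrow>
    (\<forall>c \<in> carrier_vec (dim_col X). supp c \<subseteq> T \<longrightarrow> X *\<^sub>v c = 0\<^sub>v (dim_row X) \<longrightarrow> supp c = {})"

lemma indep_cols_mono: "indep_cols X T \<Longrightarrow> S \<subseteq> T \<Longrightarrow> indep_cols X S"
  unfolding indep_cols_def by blast

text \<open>The rank is the dimension of the span of the \<^emph>\<open>set\<close> of columns, so a repeated column leaves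
  too few vectors to reach rank \<open>nc\<close>.\<close>

lemma (in vec_space) full_rank_distinct_cols:
  assumes A: "A \<in> carrier_mat n nc" and "rank A = nc"
  shows "distinct (cols A)"
proof -
  obtain U where U: "maximal U (\<lambda>T. T \<subseteq> set (cols A) \<and> lin_indpt T)"
    using maximal_exists[of "\<lambda>T. T \<subseteq> set (cols A) \<and> lin_indpt T" "card (set (cols A))" "{}"]
    by (meson List.finite_set card_mono empty_iff empty_subsetI finite_lin_indpt2 rev_finite_subset)
  then have "card U \<le> card (set (cols A))" by (simp add: card_mono maximal_def)
  then have "length (cols A) \<le> card (set (cols A))"
    using rank_card_indpt[OF A U] assms by simp
  then show ?thesis using card_length[of "cols A"] by (intro card_distinct) simp
qed

lemma full_col_rank_kernel:
  fixes A :: "'a::field mat"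
  assumes A: "A \<in> carrier_mat n m" and rank: "full_col_rank A"
    and v: "v \<in> carrier_vec m" and "A *\<^sub>v v = 0\<^sub>v n"
  shows "v = 0\<^sub>v m"
proof -
  interpret vec_space "TYPE('a)" n .
  have rk: "rank A = m" using A rank by (simp add: full_col_rank_def)
  note dist = full_rank_distinct_cols[OF A rk]
  show ?thesis
    using lin_depI[OF A v _ assms(4) dist] full_rank_lin_indpt[OF A rk dist] by blast
qed

lemma full_col_rank_imp_indep_cols:
  fixes X :: "'a::field mat"
  assumes X: "X \<in> carrier_mat n p" and T: "T \<subseteq> {..<p}"
    and rank: "full_col_rank (cols_submat X T)"
  shows "indep_cols X T"
  unfolding indep_cols_def
proof (intro ballI impI)
  fix c assume "c \<in> carrier_vec (dim_col X)" and supp: "supp c \<subseteq> T"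
    and "X *\<^sub>v c = 0\<^sub>v (dim_row X)"
  then have c: "c \<in> carrier_vec p" and Xc: "X *\<^sub>v c = 0\<^sub>v n" using X by auto
  have "restrict_vec c T = 0\<^sub>v (card T)"
    using full_col_rank_kernel[OF cols_submat_carrier[OF X T] rank restrict_vec_carrier[OF X T c]]
      cols_submat_mult_restrict_vec[OF X T c supp] Xc by simp
  then have "c $ pick T k = 0" if "k < card T" for k
    using restrict_vec_index[OF X T c that] that by simp
  then have "\<forall>j \<in> pick T ` {..<card T}. c $ j = 0" by blast
  then have "\<forall>j \<in> T. c $ j = 0"
    unfolding bij_betw_imp_surj_on[OF bij_betw_pick[OF finite_index_set[OF X T]]] .
  then show "supp c = {}" using supp by (auto simp: supp_def)
qed

lemma scalar_prod_self_eq_0: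
  fixes v :: "real vec"
  assumes "v \<in> carrier_vec n" "v \<bullet> v = 0"
  shows "v = 0\<^sub>v n"
proof (rule eq_vecI)
  fix i assume "i < dim_vec (0\<^sub>v n :: real vec)"
  then show "v $ i = 0\<^sub>v n $ i"
    using assms by (simp add: scalar_prod_def sum_nonneg_eq_0_iff)
qed (use assms in simp)

text \<open>If \<open>A\<^sup>T A v = 0\<close> then \<open>A v \<bullet> A v = A\<^sup>T A v \<bullet> v = 0\<close>, so \<open>A v = 0\<close> and independence gives \<open>v = 0\<close>.\<close>

lemma indep_cols_invertible_gram:
  fixes X :: "real mat"
  assumes X: "X \<in> carrier_mat n p" and T: "T \<subseteq> {..<p}" and ind: "indep_cols X T"
  shows "invertible_mat ((cols_submat X T)\<^sup>T * cols_submat X T)" (is "invertible_mat ?G")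
proof -
  let ?A = "cols_submat X T"
  note A = cols_submat_carrier[OF X T]
  have G: "?G \<in> carrier_mat (card T) (card T)" using A by simp
  have "v = 0\<^sub>v (card T)" if v: "v \<in> carrier_vec (card T)" and Gv: "?G *\<^sub>v v = 0\<^sub>v (card T)" for v
  proof -
    have Av: "?A *\<^sub>v v \<in> carrier_vec n" using A v by simp
    have "(?A *\<^sub>v v) \<bullet> (?A *\<^sub>v v) = (?A\<^sup>T *\<^sub>v (?A *\<^sub>v v)) \<bullet> v"
      using transpose_vec_mult_scalar[OF A v Av] by simp
    also have "?A\<^sup>T *\<^sub>v (?A *\<^sub>v v) = 0\<^sub>v (card T)"
      using Gv A v by (subst assoc_mult_mat_vec[symmetric, of _ _ n]) auto
    finally have Av0: "?A *\<^sub>v v = 0\<^sub>v n"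
      using v by (intro scalar_prod_self_eq_0[OF Av]) simp
    obtain c where c: "c \<in> carrier_vec p" "supp c \<subseteq> T" "restrict_vec c T = v"
      using restrict_vec_surj[OF X T v] by blast
    then have "X *\<^sub>v c = 0\<^sub>v n"
      using cols_submat_mult_restrict_vec[OF X T c(1,2)] Av0 by simp
    then have "supp c = {}" using ind c X by (simp add: indep_cols_def)
    then have "c $ pick T k = 0" if "k < card T" for k
      using c(1) pick_index[OF X T that] by (auto simp: supp_def)
    then have "v $ k = 0" if "k < card T" for k
      using restrict_vec_index[OF X T c(1) that] c(3) that by simp
    then show ?thesis using v by (intro eq_vecI) auto
  qed
  then have "det ?G \<noteq> 0" using det_0_iff_vec_prod_zero_field[OF G] by blast
  then obtain B where "B * ?G = 1\<^sub>m (card T)" "?G * B = 1\<^sub>m (card T)" "B \<in> carrier_mat (card T) (card T)"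
    using det_non_zero_imp_unit[OF G, of "()"] by (auto simp: Units_def ring_mat_def)
  then show ?thesis
    using G A unfolding invertible_mat_def inverts_mat_def square_mat.simps
    by (intro conjI exI[of _ B]) auto
qed

section \<open>Orthogonal projection onto selected columns\<close>

definition orth_proj :: "real mat \<Rightarrow> nat set \<Rightarrow> real vec \<Rightarrow> real vec \<Rightarrow> bool" where
  "orth_proj X T y z \<longleftrightarrow>
    (\<exists>c \<in> carrier_vec (dim_col X). supp c \<subseteq> T \<and> z = X *\<^sub>v c) \<and>
    (\<forall>i \<in> T. col X i \<bullet> (y - z) = 0)"

lemma mult_mat_vec_orthogonal:
  fixes X :: "real mat"
  assumes X: "X \<in> carrier_mat n p" and c: "c \<in> carrier_vec p" and supp: "supp c \<subseteq> T"
    and w: "w \<in> carrier_vec n" and orth: "\<forall>i \<in> T. col X i \<bullet> w = 0"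
  shows "(X *\<^sub>v c) \<bullet> w = 0"
proof -
  have "(X *\<^sub>v c) \<bullet> w = w \<bullet> (X *\<^sub>v c)"
    using X c w by (intro comm_scalar_prod[of _ n]) simp_all
  also have "\<dots> = (X\<^sup>T *\<^sub>v w) \<bullet> c"
    using transpose_vec_mult_scalar[OF X c w] by simp
  also have "\<dots> = (\<Sum>i<p. (col X i \<bullet> w) * c $ i)"
    using X c by (simp add: scalar_prod_def[of "X\<^sup>T *\<^sub>v w"] atLeast0LessThan)
  also have "\<dots> = 0"
    using supp orth c by (intro sum.neutral) (auto simp: supp_subset_iff)
  finally show ?thesis .
qed

text \<open>The coefficients \<open>v = (A\<^sup>T A)\<^sup>-\<^sup>1 A\<^sup>T y\<close> solve the normal equations \<open>A\<^sup>T A v = A\<^sup>T y\<close>, whose rows say that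
  the residual \<open>y - A v\<close> is orthogonal to each column of \<open>A\<close>.\<close>

lemma orth_proj_proj_mat:
  assumes X: "X \<in> carrier_mat n p" and T: "T \<subseteq> {..<p}" and ind: "indep_cols X T"
    and y: "y \<in> carrier_vec n"
  shows "orth_proj X T y (proj_mat X T *\<^sub>v y)"
proof -
  let ?A = "cols_submat X T"
  let ?G = "?A\<^sup>T * ?A"
  let ?H = "inv_mat ?G"
  let ?z = "proj_mat X T *\<^sub>v y"
  note A = cols_submat_carrier[OF X T]
  have G: "?G \<in> carrier_mat (card T) (card T)" using A by simp
  note H = inv_mat[OF G indep_cols_invertible_gram[OF X T ind]]
  define v where "v = ?H *\<^sub>v (?A\<^sup>T *\<^sub>v y)"
  have Ay: "?A\<^sup>T *\<^sub>v y \<in> carrier_vec (card T)" using A y by simp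
  have v: "v \<in> carrier_vec (card T)" using H(1) Ay by (simp add: v_def)
  have z: "?z = ?A *\<^sub>v v"
    unfolding proj_mat_def v_def
    using A H(1) y Ay
    by (simp add: assoc_mult_mat_vec[of _ n "card T" _ n] assoc_mult_mat_vec[of _ n "card T" _ "card T"])
  have zc: "?z \<in> carrier_vec n" using z A v by simp
  have "?A\<^sup>T *\<^sub>v ?z = ?G *\<^sub>v v"
    unfolding z using A v by (intro assoc_mult_mat_vec[symmetric]) auto
  also have "\<dots> = (?G * ?H) *\<^sub>v (?A\<^sup>T *\<^sub>v y)"
    unfolding v_def using G H(1) Ay by (intro assoc_mult_mat_vec[symmetric]) auto
  also have "\<dots> = ?A\<^sup>T *\<^sub>v y" using H(2) Ay by simp
  finally have normal: "?A\<^sup>T *\<^sub>v ?z = ?A\<^sup>T *\<^sub>v y" .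
  have "col X i \<bullet> (y - ?z) = 0" if "i \<in> T" for i
  proof -
    obtain k where k: "k < card T" and i: "i = pick T k"
      using \<open>i \<in> T\<close> bij_betw_pick[OF finite_index_set[OF X T]] by (auto simp: bij_betw_def)
    have col: "col ?A k = col X i"
      using k X A pick_index[OF X T k]
      by (intro eq_vecI) (simp_all add: i cols_submat_index[OF X T])
    have "col ?A k \<bullet> ?z = col ?A k \<bullet> y"
      using arg_cong[OF normal, of "\<lambda>w. w $ k"] k A by simp
    then show ?thesis
      unfolding col using X y zc by (subst scalar_prod_minus_distrib[of _ n]) auto
  qed
  moreover obtain c where "c \<in> carrier_vec p" "supp c \<subseteq> T" "restrict_vec c T = v"
    using restrict_vec_surj[OF X T v] by blast
  ultimately show ?thesis
    using z X cols_submat_mult_restrict_vec[OF X T] unfolding orth_proj_def by (metis carrier_matD(2))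
qed

lemma orth_proj_carrier: "orth_proj X T y z \<Longrightarrow> X \<in> carrier_mat n p \<Longrightarrow> z \<in> carrier_vec n"
  unfolding orth_proj_def by fastforce

lemma orth_projE:
  assumes "orth_proj X T y z" "X \<in> carrier_mat n p"
  obtains c where "c \<in> carrier_vec p" "supp c \<subseteq> T" "z = X *\<^sub>v c"
  using assms unfolding orth_proj_def by auto

lemma orth_proj_orthogonal:
  "orth_proj X T y z \<Longrightarrow> i \<in> T \<Longrightarrow> col X i \<bullet> (y - z) = 0"
  unfolding orth_proj_def by blast

text \<open>The difference of two candidates lies in the span and is orthogonal to it, hence to itself.\<close>

lemma orth_proj_unique:
  assumes X: "X \<in> carrier_mat n p" and y: "y \<in> carrier_vec n"
    and z: "orth_proj X T y z" and z': "orth_proj X T y z'"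
  shows "z = z'"
proof -
  obtain c where c: "c \<in> carrier_vec p" "supp c \<subseteq> T" "z = X *\<^sub>v c" by (rule orth_projE[OF z X])
  obtain c' where c': "c' \<in> carrier_vec p" "supp c' \<subseteq> T" "z' = X *\<^sub>v c'" by (rule orth_projE[OF z' X])
  note zc = orth_proj_carrier[OF z X] orth_proj_carrier[OF z' X]
  have d: "z - z' = X *\<^sub>v (c - c')"
    using mult_minus_distrib_mat_vec[OF X c(1) c'(1)] c(3) c'(3) by simp
  have "col X i \<bullet> (z - z') = 0" if "i \<in> T" for i
  proof -
    have "z - z' = (y - z') - (y - z)" using y zc by (intro eq_vecI) auto
    moreover have "col X i \<bullet> ((y - z') - (y - z)) = col X i \<bullet> (y - z') - col X i \<bullet> (y - z)"
      using X y zc by (intro scalar_prod_minus_distrib[of _ n]) auto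
    ultimately show ?thesis
      using orth_proj_orthogonal[OF z that] orth_proj_orthogonal[OF z' that] by simp
  qed
  then have "(z - z') \<bullet> (z - z') = 0"
    unfolding d using c c' X
    by (intro mult_mat_vec_orthogonal[of X n p _ T]) (auto simp: supp_subset_iff)
  then have "z - z' = 0\<^sub>v n" using zc by (intro scalar_prod_self_eq_0) auto
  then have "(z - z') $ i = 0" if "i < n" for i using that by simp
  then show ?thesis using zc by (intro eq_vecI) auto
qed

lemma mult_ls_coeff:
  fixes X :: "real mat"
  assumes X: "X \<in> carrier_mat n p" and S: "S \<subseteq> {..<p}" and ind: "indep_cols X S"
    and y: "y \<in> carrier_vec n" and b: "\<beta> \<in> carrier_vec p" "supp \<beta> \<subseteq> S"
    and ls: "restrict_vec \<beta> S = ls_coeff X S y"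
  shows "X *\<^sub>v \<beta> = proj_mat X S *\<^sub>v y"
proof -
  let ?A = "cols_submat X S"
  note A = cols_submat_carrier[OF X S]
  have "inv_mat (?A\<^sup>T * ?A) \<in> carrier_mat (card S) (card S)"
    using A indep_cols_invertible_gram[OF X S ind] by (intro inv_mat(1)) auto
  then have "?A *\<^sub>v ls_coeff X S y = proj_mat X S *\<^sub>v y"
    unfolding ls_coeff_def proj_mat_def using A y
    by (simp add: assoc_mult_mat[of _ n "card S" _ "card S" _ n] assoc_mult_mat_vec[of _ n "card S" _ n])
  then show ?thesis using cols_submat_mult_restrict_vec[OF X S b] ls by simp
qed

section \<open>Adding one column\<close>

text \<open>Adding a multiple of \<open>u\<close> to \<open>z\<close> keeps the residual orthogonal to the columns of \<open>S\<close>, because \<open>u\<close> is;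
  the multiple is the one that makes the residual orthogonal to column \<open>j\<close> as well.\<close>

lemma orth_proj_insert:
  assumes X: "X \<in> carrier_mat n p" and j: "j < p"
    and y: "y \<in> carrier_vec n" and z: "orth_proj X S y z" and q: "orth_proj X S (col X j) q"
    and u: "u = col X j - q" "u \<bullet> col X j \<noteq> 0"
  shows "orth_proj X (S \<union> {j}) y (z + ((y - z) \<bullet> col X j / (u \<bullet> col X j)) \<cdot>\<^sub>v u)"
    (is "orth_proj X _ y (z + ?a \<cdot>\<^sub>v u)")
proof -
  obtain c where c: "c \<in> carrier_vec p" "supp c \<subseteq> S" "z = X *\<^sub>v c" by (rule orth_projE[OF z X])
  obtain d where d: "d \<in> carrier_vec p" "supp d \<subseteq> S" "q = X *\<^sub>v d" by (rule orth_projE[OF q X])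
  note zc = orth_proj_carrier[OF z X]
  note qc = orth_proj_carrier[OF q X]
  have cj: "col X i \<in> carrier_vec n" for i using X by auto
  have uc: "u \<in> carrier_vec n" using u cj qc by simp
  let ?e = "c + ?a \<cdot>\<^sub>v (unit_vec p j - d)"
  have unit: "X *\<^sub>v unit_vec p j = col X j"
    using X j by (intro eq_vecI) auto
  have "X *\<^sub>v ?e = X *\<^sub>v c + ?a \<cdot>\<^sub>v (X *\<^sub>v unit_vec p j - X *\<^sub>v d)"
    using X c d by (simp add: mult_add_distrib_mat_vec mult_minus_distrib_mat_vec mult_mat_vec)
  then have span: "z + ?a \<cdot>\<^sub>v u = X *\<^sub>v ?e" using c d u unit by simp
  have "supp ?e \<subseteq> S \<union> {j}" using c d j by (auto simp: supp_subset_iff unit_vec_def)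
  moreover have "col X i \<bullet> (y - (z + ?a \<cdot>\<^sub>v u)) = 0" if "i \<in> S \<union> {j}" for i
  proof -
    have "y - (z + ?a \<cdot>\<^sub>v u) = (y - z) - ?a \<cdot>\<^sub>v u"
      using y zc uc by (intro eq_vecI) auto
    then have "col X i \<bullet> (y - (z + ?a \<cdot>\<^sub>v u)) = col X i \<bullet> (y - z) - ?a * (col X i \<bullet> u)"
      using cj[of i] y zc uc by (simp add: scalar_prod_minus_distrib[of _ n])
    also have "\<dots> = 0"
    proof (cases "i \<in> S")
      case True
      then show ?thesis using orth_proj_orthogonal[OF z] orth_proj_orthogonal[OF q] u by simp
    next
      case False
      then have "i = j" using that by simp
      moreover have "col X j \<bullet> (y - z) = (y - z) \<bullet> col X j"
        using cj y zc by (intro comm_scalar_prod[of _ n]) auto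
      moreover have "col X j \<bullet> u = u \<bullet> col X j"
        using cj uc by (intro comm_scalar_prod[of _ n]) auto
      ultimately show ?thesis using u by simp
    qed
    finally show ?thesis .
  qed
  ultimately show ?thesis
    unfolding orth_proj_def using span c d X by (intro conjI bexI[of _ ?e]) auto
qed

text \<open>The gain identity. Orthogonality of \<open>u = x - q\<close>, where \<open>x = col X j\<close>, to the span of \<open>S\<close> gives
  \<open>u \<bullet> x = u \<bullet> u\<close>, which is positive by independence, and \<open>y \<bullet> u = r \<bullet> x\<close> for \<open>r = y - P\<^sub>S y\<close>. The
  coefficient of \<open>u\<close> in the update carries one factor \<open>r \<bullet> x\<close> and \<open>y \<bullet> u\<close> the other, whence the square.\<close>

lemma proj_mat_insert:
  fixes X :: "real mat"
  assumes X: "X \<in> carrier_mat n p" and S: "S \<subseteq> {..<p}" and j: "j < p" "j \<notin> S"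
    and ind: "indep_cols X (S \<union> {j})" and y: "y \<in> carrier_vec n"
  shows "y \<bullet> (proj_mat X (S \<union> {j}) *\<^sub>v y) = y \<bullet> (proj_mat X S *\<^sub>v y) +
    ((y - proj_mat X S *\<^sub>v y) \<bullet> col X j)\<^sup>2 / (col X j \<bullet> ((1\<^sub>m n - proj_mat X S) *\<^sub>v col X j))"
proof -
  have Sj: "S \<union> {j} \<subseteq> {..<p}" using S j by simp
  have indS: "indep_cols X S" using ind by (rule indep_cols_mono) auto
  have cj: "col X j \<in> carrier_vec n" using X by auto
  define z where "z = proj_mat X S *\<^sub>v y"
  define q where "q = proj_mat X S *\<^sub>v col X j"
  define u where "u = col X j - q"
  have z: "orth_proj X S y z" unfolding z_def by (rule orth_proj_proj_mat[OF X S indS y])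
  have q: "orth_proj X S (col X j) q" unfolding q_def by (rule orth_proj_proj_mat[OF X S indS cj])
  obtain c where c: "c \<in> carrier_vec p" "supp c \<subseteq> S" "z = X *\<^sub>v c" by (rule orth_projE[OF z X])
  obtain d where d: "d \<in> carrier_vec p" "supp d \<subseteq> S" "q = X *\<^sub>v d" by (rule orth_projE[OF q X])
  note zc = orth_proj_carrier[OF z X]
  note qc = orth_proj_carrier[OF q X]
  have uc: "u \<in> carrier_vec n" using cj qc by (simp add: u_def)
  have P: "proj_mat X S \<in> carrier_mat n n"
    using cols_submat_carrier[OF X S] by (intro carrier_matI) (simp_all add: proj_mat_def)
  have denom: "(1\<^sub>m n - proj_mat X S) *\<^sub>v col X j = u"
    using minus_mult_distrib_mat_vec[OF one_carrier_mat P cj] cj by (simp add: u_def q_def)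
  have u_orth: "\<forall>i \<in> S. col X i \<bullet> u = 0" using q by (simp add: orth_proj_def u_def)
  have zu: "z \<bullet> u = 0" unfolding c(3) by (rule mult_mat_vec_orthogonal[OF X c(1,2) uc u_orth])
  have qu: "q \<bullet> u = 0" unfolding d(3) by (rule mult_mat_vec_orthogonal[OF X d(1,2) uc u_orth])
  have comm: "col X j \<bullet> u = u \<bullet> col X j" using cj uc by (rule comm_scalar_prod)
  have "u \<bullet> u = col X j \<bullet> u - q \<bullet> u"
    using minus_scalar_prod_distrib[OF cj qc uc] by (simp add: u_def)
  then have uu: "u \<bullet> u = u \<bullet> col X j" using qu comm by simp
  have u0: "u \<bullet> col X j \<noteq> 0"
  proof
    assume "u \<bullet> col X j = 0"
    then have "u = 0\<^sub>v n" using uu uc by (intro scalar_prod_self_eq_0) simp_all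
    \<comment> \<open>Column \<open>j\<close> would equal \<open>q = X d\<close>, a dependence whose coefficient at \<open>j\<close> is \<open>1\<close>,
        since \<open>d\<close> vanishes outside \<open>S\<close>.\<close>
    let ?e = "unit_vec p j - d"
    have "X *\<^sub>v unit_vec p j = col X j" using X j by (intro eq_vecI) auto
    then have "X *\<^sub>v ?e = u"
      using mult_minus_distrib_mat_vec[OF X _ d(1), of "unit_vec p j"] d(3) by (simp add: u_def)
    moreover have "supp ?e \<subseteq> S \<union> {j}" using d j by (auto simp: supp_subset_iff unit_vec_def)
    ultimately have "supp ?e = {}" using ind d X \<open>u = 0\<^sub>v n\<close> by (simp add: indep_cols_def)
    moreover have "j \<in> supp ?e" using d j by (auto simp: supp_subset_iff supp_def)
    ultimately show False by simp
  qed
  let ?a = "(y - z) \<bullet> col X j / (u \<bullet> col X j)"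
  have "proj_mat X (S \<union> {j}) *\<^sub>v y = z + ?a \<cdot>\<^sub>v u"
    by (rule orth_proj_unique[OF X y orth_proj_proj_mat[OF X Sj ind y]
        orth_proj_insert[OF X j(1) y z q u_def u0]])
  moreover have "y \<bullet> (z + ?a \<cdot>\<^sub>v u) = y \<bullet> z + ?a * (y \<bullet> u)"
    using y zc uc by (simp add: scalar_prod_add_distrib[of _ n])
  moreover have "y \<bullet> u = (y - z) \<bullet> col X j"
  proof -
    have yz: "y - z \<in> carrier_vec n" using y zc by simp
    have "y \<bullet> u = (y - z) \<bullet> u"
      using minus_scalar_prod_distrib[OF y zc uc] zu by simp
    also have "\<dots> = (y - z) \<bullet> col X j - (y - z) \<bullet> q"
      unfolding u_def using scalar_prod_minus_distrib[OF yz cj qc] by simp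
    also have "(y - z) \<bullet> q = q \<bullet> (y - z)" using yz qc by (rule comm_scalar_prod)
    also have "q \<bullet> (y - z) = 0"
      unfolding d(3) using z by (intro mult_mat_vec_orthogonal[OF X d(1,2) yz]) (simp add: orth_proj_def)
    finally show ?thesis by simp
  qed
  ultimately show ?thesis
    unfolding denom comm by (simp add: z_def[symmetric] power2_eq_square)
qed

section \<open>Equivalence of the two problems\<close>

lemma superset_card_Suc_iff:
  assumes "S \<subseteq> U" "finite U"
  shows "(S \<subseteq> T \<and> T \<subseteq> U \<and> card T = card S + 1) \<longleftrightarrow> (\<exists>j \<in> U - S. T = S \<union> {j})"
proof
  assume T: "S \<subseteq> T \<and> T \<subseteq> U \<and> card T = card S + 1"
  then have fin: "finite S" "finite T" using assms finite_subset by blast+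
  then have "card (T - S) = 1" using T by (simp add: card_Diff_subset)
  then obtain j where "T - S = {j}" by (auto simp: card_1_singleton_iff)
  with T show "\<exists>j \<in> U - S. T = S \<union> {j}" by (intro bexI[of _ j]) auto
next
  have "finite S" using assms finite_subset by blast
  moreover assume "\<exists>j \<in> U - S. T = S \<union> {j}"
  ultimately show "S \<subseteq> T \<and> T \<subseteq> U \<and> card T = card S + 1" using assms by auto
qed

lemma is_arg_max_image_iff:
  fixes f :: "'a \<Rightarrow> 'b::linordered_ab_group_add"
  assumes j: "j \<in> J" and shift: "\<And>i. i \<in> J \<Longrightarrow> F (h i) = c + f i"
  shows "is_arg_max f (\<lambda>i. i \<in> J) j \<longleftrightarrow> is_arg_max F (\<lambda>T. T \<in> h ` J) (h j)"
  unfolding is_arg_max_def using j by (auto simp: shift)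

theorem theorem3p3:
  fixes X :: "real mat" and y \<beta> r :: "real vec" and n p :: nat and S :: "nat set"
  assumes "X \<in> carrier_mat n p"
    and "y \<in> carrier_vec n"
    and "\<beta> \<in> carrier_vec p"
    and "S = supp \<beta>"
    and "S \<subset> {..<p}"
    and "restrict_vec \<beta> S = ls_coeff X S y"
    and "r = y - X *\<^sub>v \<beta>"
    and "\<forall>j \<in> {..<p} - S. full_col_rank (cols_submat X (S \<union> {j}))"
  shows "\<forall>j \<in> {..<p} - S.
    is_arg_max (\<lambda>j. (r \<bullet> col X j)\<^sup>2 / (col X j \<bullet> ((1\<^sub>m n - proj_mat X S) *\<^sub>v col X j)))
        (\<lambda>j. j \<in> {..<p} - S) j
    \<longleftrightarrow>
    is_arg_max (\<lambda>T. y \<bullet> (proj_mat X T *\<^sub>v y))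
        (\<lambda>T. S \<subseteq> T \<and> T \<subseteq> {..<p} \<and> card T = card S + 1) (S \<union> {j})"
proof -
  note X = assms(1) and y = assms(2)
  have S: "S \<subseteq> {..<p}" using assms(5) by blast
  have ind: "indep_cols X (S \<union> {j})" if "j \<in> {..<p} - S" for j
    using assms(8) that S by (intro full_col_rank_imp_indep_cols[OF X]) auto
  \<comment> \<open>Independence of the columns in \<open>S\<close> itself is inherited from some \<open>S \<union> {j0}\<close>, which exists
      because \<open>S\<close> is a proper subset.\<close>
  obtain j0 where "j0 \<in> {..<p} - S" using assms(5) by blast
  then have "indep_cols X S" using indep_cols_mono[OF ind] by blast
  then have r: "r = y - proj_mat X S *\<^sub>v y"
    using mult_ls_coeff[OF X S _ y assms(3) _ assms(6)] assms(4,7) by simp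
  have gain: "y \<bullet> (proj_mat X (S \<union> {j}) *\<^sub>v y) = y \<bullet> (proj_mat X S *\<^sub>v y) +
      (r \<bullet> col X j)\<^sup>2 / (col X j \<bullet> ((1\<^sub>m n - proj_mat X S) *\<^sub>v col X j))"
    if "j \<in> {..<p} - S" for j
    using proj_mat_insert[OF X S _ _ ind[OF that] y] that r by simp
  show ?thesis
  proof
    fix j assume j: "j \<in> {..<p} - S"
    have sup: "(\<lambda>T. S \<subseteq> T \<and> T \<subseteq> {..<p} \<and> card T = card S + 1)
        = (\<lambda>T. T \<in> (\<lambda>i. S \<union> {i}) ` ({..<p} - S))"
      by (rule ext) (simp only: superset_card_Suc_iff[OF S finite_lessThan] image_iff)
    show "is_arg_max (\<lambda>j. (r \<bullet> col X j)\<^sup>2 / (col X j \<bullet> ((1\<^sub>m n - proj_mat X S) *\<^sub>v col X j)))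
        (\<lambda>j. j \<in> {..<p} - S) j
      \<longleftrightarrow> is_arg_max (\<lambda>T. y \<bullet> (proj_mat X T *\<^sub>v y))
        (\<lambda>T. S \<subseteq> T \<and> T \<subseteq> {..<p} \<and> card T = card S + 1) (S \<union> {j})"
      unfolding sup
      by (rule is_arg_max_image_iff[where h = "\<lambda>i. S \<union> {i}" and F = "\<lambda>T. y \<bullet> (proj_mat X T *\<^sub>v y)",
            OF j gain])
  qed
qed

end
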